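(* Let $G$ be a group such that $x\otimes x=1_\otimes$ in $G\otimes G$ for all $x\in G$. Then $(R_2^\otimes(G))'\subseteq Z_2^\otimes(G)$, where $(R_2^\otimes(G))'$ denotes the derived (commutator) subgroup of $R_2^\otimes(G)$.
   Context: Conventions: $g^h=h^{-1}gh$ and $[g,h]=g^{-1}h^{-1}gh$. For a group $G$, the non-abelian tensor square $G\otimes G$ is the group generated by symbols $g\otimes h$ ($g,h\in G$) subject to the relations $gg'\otimes h=(g^{g'}\otimes h^{g'})(g'\otimes h)$ and $g\otimes hh'=(g\otimes h')(g^{h'}\otimes h^{h'})$ for all $g,g',h,h'\in G$; its identity is $1_\otimes$. $R_2^\otimes(G)=\{g\in G : [g,x]\otimes x=1_\otimes \text{ for all } x\in G\}$ (the right $2_\otimes$-Engel elements); it is known (Biddle–Kappe) to be a characteristic subgroup of $G$ containing $Z(G)$. $Z_2^\otimes(G)=\{a\in G : [a,g_1]\otimes g_2=1_\otimes \text{ for all } g_1,g_2\in G\}$ (the second tensor center); it is a characteristic subgroup of $G$. *)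

theory Defs
  imports "HOL-Algebra.Generated_Groups"
begin

section \<open>Groups given by generators and relations\<close>

text \<open>
  A word over the generators is a list of letters; the letter \<open>(x, True)\<close> stands for the
  generator \<open>x\<close> and \<open>(x, False)\<close> for its formal inverse.
\<close>

type_synonym 'g word = "('g \<times> bool) list"

abbreviation words :: "'g set \<Rightarrow> 'g word set" where
  "words X \<equiv> lists (X \<times> UNIV)"

text \<open>
  A relation \<open>u = v\<close> of the presentation is the pair \<open>(u, v)\<close>; pairs in \<open>R\<close> that are not words
  over \<open>X\<close> are ignored.
\<close>

inductive_set pres_rel :: "'g set \<Rightarrow> ('g word \<times> 'g word) set \<Rightarrow> ('g word \<times> 'g word) set"
  for X :: "'g set" and R :: "('g word \<times> 'g word) set" where
  refl: "w \<in> words X \<Longrightarrow> (w, w) \<in> pres_rel X R"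
| sym: "(u, v) \<in> pres_rel X R \<Longrightarrow> (v, u) \<in> pres_rel X R"
| trans: "(u, v) \<in> pres_rel X R \<Longrightarrow> (v, w) \<in> pres_rel X R \<Longrightarrow> (u, w) \<in> pres_rel X R"
| mult: "(u, v) \<in> pres_rel X R \<Longrightarrow> (u', v') \<in> pres_rel X R \<Longrightarrow> (u @ u', v @ v') \<in> pres_rel X R"
| cancel: "x \<in> X \<Longrightarrow> ([(x, b), (x, \<not> b)], []) \<in> pres_rel X R"
| rel: "(u, v) \<in> R \<Longrightarrow> u \<in> words X \<Longrightarrow> v \<in> words X \<Longrightarrow> (u, v) \<in> pres_rel X R"

definition presented_group :: "'g set \<Rightarrow> ('g word \<times> 'g word) set \<Rightarrow> 'g word set monoid" where
  "presented_group X R =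
    \<lparr>carrier = words X // pres_rel X R,
     mult = (\<lambda>A B. pres_rel X R `` {u @ v | u v. u \<in> A \<and> v \<in> B}),
     one = pres_rel X R `` {[]}\<rparr>"

lemma pres_rel_words: "(u, v) \<in> pres_rel X R \<Longrightarrow> u \<in> words X \<and> v \<in> words X"
  by (induction rule: pres_rel.induct) auto

lemma equiv_pres_rel: "equiv (words X) (pres_rel X R)"
proof (rule equivI)
  show "pres_rel X R \<subseteq> words X \<times> words X" using pres_rel_words by fast
  show "refl_on (words X) (pres_rel X R)"
    using pres_rel_words by (auto intro!: refl_onI pres_rel.refl)
  show "Relation.sym (pres_rel X R)" by (auto intro: symI pres_rel.sym)
  show "Relation.trans (pres_rel X R)" by (blast intro: transI pres_rel.trans)
qed

lemma presented_mult_class: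
  assumes "u \<in> words X" "v \<in> words X"
  shows "(pres_rel X R `` {u}) \<otimes>\<^bsub>presented_group X R\<^esub> (pres_rel X R `` {v}) = pres_rel X R `` {u @ v}"
proof -
  have "(u @ v, w) \<in> pres_rel X R"
    if "(u, u') \<in> pres_rel X R" "(v, v') \<in> pres_rel X R" "(u' @ v', w) \<in> pres_rel X R" for u' v' w
    using that by (blast intro: pres_rel.trans pres_rel.mult)
  moreover have "(u, u) \<in> pres_rel X R" "(v, v) \<in> pres_rel X R"
    using assms by (auto intro: pres_rel.refl)
  ultimately show ?thesis unfolding presented_group_def by auto
qed

lemma pres_inverse_exists:
  "w \<in> words X \<Longrightarrow> \<exists>v \<in> words X. (v @ w, []) \<in> pres_rel X R"
proof (induction w)
  case Nil
  show ?case using pres_rel.refl[of "[]" X R] by force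
next
  case (Cons a w)
  obtain x b where a: "a = (x, b)" "x \<in> X" using Cons.prems by (cases a) auto
  obtain v where v: "v \<in> words X" "(v @ w, []) \<in> pres_rel X R" using Cons by auto
  have w: "w \<in> words X" using Cons.prems by auto
  have c: "([(x, \<not> b), (x, b)], []) \<in> pres_rel X R" using pres_rel.cancel[of x X "\<not> b" R] a by simp
  have "(v @ ([(x, \<not> b), (x, b)] @ w), v @ ([] @ w)) \<in> pres_rel X R"
    by (intro pres_rel.mult pres_rel.refl c v w)
  then have "((v @ [(x, \<not> b)]) @ a # w, []) \<in> pres_rel X R"
    using v a by (auto intro: pres_rel.trans)
  moreover have "v @ [(x, \<not> b)] \<in> words X" using v a by auto
  ultimately show ?case by blast
qed

lemma group_presented_group: "group (presented_group X R)"
proof -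
  let ?P = "presented_group X R"
  have car: "\<exists>w \<in> words X. A = pres_rel X R `` {w}" if "A \<in> carrier ?P" for A
    using that unfolding presented_group_def by (auto elim!: quotientE)
  have cl: "pres_rel X R `` {w} \<in> carrier ?P" if "w \<in> words X" for w
    using that unfolding presented_group_def by (auto intro: quotientI)
  have one: "\<one>\<^bsub>?P\<^esub> = pres_rel X R `` {[]}" unfolding presented_group_def by simp
  show ?thesis
  proof (rule groupI)
    show "\<one>\<^bsub>?P\<^esub> \<in> carrier ?P" unfolding one by (rule cl) simp
  next
    fix A B assume "A \<in> carrier ?P" "B \<in> carrier ?P"
    then obtain u v where uv: "u \<in> words X" "A = pres_rel X R `` {u}"
      "v \<in> words X" "B = pres_rel X R `` {v}" using car by (metis (no_types, lifting))
    then show "A \<otimes>\<^bsub>?P\<^esub> B \<in> carrier ?P" by (simp add: presented_mult_class cl del: in_lists_conv_set)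
  next
    fix A B C assume "A \<in> carrier ?P" "B \<in> carrier ?P" "C \<in> carrier ?P"
    then obtain u v w where *: "u \<in> words X" "A = pres_rel X R `` {u}"
      "v \<in> words X" "B = pres_rel X R `` {v}" "w \<in> words X" "C = pres_rel X R `` {w}" using car by (metis (no_types, lifting))
    then have "u @ v \<in> words X" "v @ w \<in> words X" by auto
    with * show "A \<otimes>\<^bsub>?P\<^esub> B \<otimes>\<^bsub>?P\<^esub> C = A \<otimes>\<^bsub>?P\<^esub> (B \<otimes>\<^bsub>?P\<^esub> C)"
      by (simp add: presented_mult_class del: in_lists_conv_set)
  next
    fix A assume "A \<in> carrier ?P"
    then obtain u where u: "u \<in> words X" "A = pres_rel X R `` {u}" using car by (metis (no_types, lifting))
    have "[] \<in> words X" by simp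
    with u show "\<one>\<^bsub>?P\<^esub> \<otimes>\<^bsub>?P\<^esub> A = A"
      by (simp add: one presented_mult_class del: in_lists_conv_set)
    obtain v where v: "v \<in> words X" "(v @ u, []) \<in> pres_rel X R"
      using pres_inverse_exists[OF u(1)] by blast
    then have "pres_rel X R `` {v} \<otimes>\<^bsub>?P\<^esub> A = \<one>\<^bsub>?P\<^esub>"
      using u equiv_class_eq[OF equiv_pres_rel v(2)]
      by (simp add: one presented_mult_class del: in_lists_conv_set)
    with cl[OF v(1)] show "\<exists>B\<in>carrier ?P. B \<otimes>\<^bsub>?P\<^esub> A = \<one>\<^bsub>?P\<^esub>" by blast
  qed
qed

section \<open>The non-abelian tensor square\<close>

definition conjugate :: "('a, 'b) monoid_scheme \<Rightarrow> 'a \<Rightarrow> 'a \<Rightarrow> 'a" where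
  "conjugate G g h = inv\<^bsub>G\<^esub> h \<otimes>\<^bsub>G\<^esub> g \<otimes>\<^bsub>G\<^esub> h"

definition commutator :: "('a, 'b) monoid_scheme \<Rightarrow> 'a \<Rightarrow> 'a \<Rightarrow> 'a" where
  "commutator G g h = inv\<^bsub>G\<^esub> g \<otimes>\<^bsub>G\<^esub> inv\<^bsub>G\<^esub> h \<otimes>\<^bsub>G\<^esub> g \<otimes>\<^bsub>G\<^esub> h"

text \<open>The symbol of a pair \<open>(g, h)\<close> is the generator written $g \otimes h$.\<close>

definition tensor_relations :: "('a, 'b) monoid_scheme \<Rightarrow> (('a \<times> 'a) word \<times> ('a \<times> 'a) word) set" where
  "tensor_relations G =
    {([((g \<otimes>\<^bsub>G\<^esub> g', h), True)],
      [((conjugate G g g', conjugate G h g'), True), ((g', h), True)])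
     | g g' h. g \<in> carrier G \<and> g' \<in> carrier G \<and> h \<in> carrier G}
    \<union>
    {([((g, h \<otimes>\<^bsub>G\<^esub> h'), True)],
      [((g, h'), True), ((conjugate G g h', conjugate G h h'), True)])
     | g h h'. g \<in> carrier G \<and> h \<in> carrier G \<and> h' \<in> carrier G}"

definition tensor_square :: "('a, 'b) monoid_scheme \<Rightarrow> ('a \<times> 'a) word set monoid" where
  "tensor_square G = presented_group (carrier G \<times> carrier G) (tensor_relations G)"

definition tensor :: "('a, 'b) monoid_scheme \<Rightarrow> 'a \<Rightarrow> 'a \<Rightarrow> ('a \<times> 'a) word set" where
  "tensor G g h = pres_rel (carrier G \<times> carrier G) (tensor_relations G) `` {[((g, h), True)]}"

lemma group_tensor_square: "group (tensor_square G)"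
  unfolding tensor_square_def by (rule group_presented_group)

lemma tensor_closed:
  assumes "g \<in> carrier G" "h \<in> carrier G"
  shows "tensor G g h \<in> carrier (tensor_square G)"
  using assms unfolding tensor_def tensor_square_def presented_group_def by (auto intro!: quotientI)

lemma conjugate_closed:
  assumes "group G" "g \<in> carrier G" "h \<in> carrier G"
  shows "conjugate G g h \<in> carrier G"
  using assms unfolding conjugate_def by (simp add: group.is_monoid monoid.m_closed)

lemma tensor_mult_left:
  assumes "group G" "g \<in> carrier G" "g' \<in> carrier G" "h \<in> carrier G"
  shows "tensor G (g \<otimes>\<^bsub>G\<^esub> g') h =
    tensor G (conjugate G g g') (conjugate G h g') \<otimes>\<^bsub>tensor_square G\<^esub> tensor G g' h"
proof -
  interpret group G by fact
  let ?X = "carrier G \<times> carrier G" and ?R = "tensor_relations G"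
  have "([((g \<otimes>\<^bsub>G\<^esub> g', h), True)],
      [((conjugate G g g', conjugate G h g'), True), ((g', h), True)]) \<in> pres_rel ?X ?R"
    using assms conjugate_closed[OF \<open>group G\<close>] by (intro pres_rel.rel) (auto simp: tensor_relations_def)
  from equiv_class_eq[OF equiv_pres_rel this] show ?thesis
    using assms conjugate_closed[OF \<open>group G\<close>] unfolding tensor_def tensor_square_def
    by (subst presented_mult_class) auto
qed

lemma tensor_mult_right:
  assumes "group G" "g \<in> carrier G" "h \<in> carrier G" "h' \<in> carrier G"
  shows "tensor G g (h \<otimes>\<^bsub>G\<^esub> h') =
    tensor G g h' \<otimes>\<^bsub>tensor_square G\<^esub> tensor G (conjugate G g h') (conjugate G h h')"
proof -
  interpret group G by fact
  let ?X = "carrier G \<times> carrier G" and ?R = "tensor_relations G"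
  have "([((g, h \<otimes>\<^bsub>G\<^esub> h'), True)],
      [((g, h'), True), ((conjugate G g h', conjugate G h h'), True)]) \<in> pres_rel ?X ?R"
    using assms conjugate_closed[OF \<open>group G\<close>] by (intro pres_rel.rel) (auto simp: tensor_relations_def)
  from equiv_class_eq[OF equiv_pres_rel this] show ?thesis
    using assms conjugate_closed[OF \<open>group G\<close>] unfolding tensor_def tensor_square_def
    by (subst presented_mult_class) auto
qed

definition right_2_tensor_engel :: "('a, 'b) monoid_scheme \<Rightarrow> 'a set" where
  "right_2_tensor_engel G =
    {g \<in> carrier G. \<forall>x \<in> carrier G. tensor G (commutator G g x) x = \<one>\<^bsub>tensor_square G\<^esub>}"

definition second_tensor_center :: "('a, 'b) monoid_scheme \<Rightarrow> 'a set" where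
  "second_tensor_center G =
    {a \<in> carrier G. \<forall>g\<^sub>1 \<in> carrier G. \<forall>g\<^sub>2 \<in> carrier G.
       tensor G (commutator G a g\<^sub>1) g\<^sub>2 = \<one>\<^bsub>tensor_square G\<^esub>}"

text \<open>
  The library's \<^const>\<open>derived\<close> is generated by the commutators $a b a^{-1} b^{-1}$ rather than by
  $a^{-1} b^{-1} a b$; on a subgroup both choices generate the same derived subgroup.
\<close>

lemma derived_eq_generate_commutator:
  assumes "group G" "subgroup H G"
  shows "derived G H = generate G {commutator G a b | a b. a \<in> H \<and> b \<in> H}"
proof -
  interpret group G by fact
  interpret H: subgroup H G by fact
  have 1: "\<exists>a' b'. a \<otimes>\<^bsub>G\<^esub> b \<otimes>\<^bsub>G\<^esub> inv\<^bsub>G\<^esub> a \<otimes>\<^bsub>G\<^esub> inv\<^bsub>G\<^esub> b = commutator G a' b' \<and> a' \<in> H \<and> b' \<in> H"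
    if "a \<in> H" "b \<in> H" for a b
    using that unfolding commutator_def
    by (intro exI[of _ "inv\<^bsub>G\<^esub> a"] exI[of _ "inv\<^bsub>G\<^esub> b"]) simp
  have 2: "\<exists>a'\<in>H. \<exists>b'\<in>H. commutator G a b = a' \<otimes>\<^bsub>G\<^esub> b' \<otimes>\<^bsub>G\<^esub> inv\<^bsub>G\<^esub> a' \<otimes>\<^bsub>G\<^esub> inv\<^bsub>G\<^esub> b'"
    if "a \<in> H" "b \<in> H" for a b
    using that unfolding commutator_def
    by (intro bexI[of _ "inv\<^bsub>G\<^esub> a"] bexI[of _ "inv\<^bsub>G\<^esub> b"]) simp_all
  have "derived_set G H = {commutator G a b | a b. a \<in> H \<and> b \<in> H}"
  proof (intro equalityI subsetI)
    fix x assume "x \<in> derived_set G H"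
    then obtain a b where ab: "a \<in> H" "b \<in> H"
      "x = a \<otimes>\<^bsub>G\<^esub> b \<otimes>\<^bsub>G\<^esub> inv\<^bsub>G\<^esub> a \<otimes>\<^bsub>G\<^esub> inv\<^bsub>G\<^esub> b" by auto
    show "x \<in> {commutator G a b | a b. a \<in> H \<and> b \<in> H}"
      unfolding mem_Collect_eq ab(3) by (rule 1[OF ab(1,2)])
  next
    fix x assume "x \<in> {commutator G a b | a b. a \<in> H \<and> b \<in> H}"
    then obtain a b where ab: "a \<in> H" "b \<in> H" "x = commutator G a b" by auto
    show "x \<in> derived_set G H"
      unfolding UN_iff singleton_iff ab(3) by (rule 2[OF ab(1,2)])
  qed
  then show ?thesis unfolding derived_def by simp
qed

end

theory Submission
  imports Defs
begin

text \<open>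
  When all \<open>x \<otimes> x\<close> vanish, the tensor square behaves like the commutator subgroup of a central
  extension of \<open>G\<close>, and the claim becomes: if \<open>a\<close> and \<open>b\<close> are right 2-Engel elements, then
  \<open>[a, b, x, y] = 1\<close>. As in Levi's theorem on 2-Engel groups, the normal closure of \<open>a\<close> is
  abelian, \<open>[a, x, y]\<close> is alternating in \<open>x\<close> and \<open>y\<close>, and comparing a cyclic rotation of
  \<open>[a, x, y, z]\<close> with two transpositions gives \<open>[a, [x, y], z] = [a, x, y, z]\<^sup>2 = 1\<close>.
  Finally \<open>[a, b, x] = [a, x, b]\<^sup>-\<^sup>1 = [b, [a, x]]\<close> commutes with every \<open>y\<close>.
\<close>

section \<open>Homomorphisms out of a presented group\<close>

fun word_value :: "('b, 'c) monoid_scheme \<Rightarrow> ('g \<Rightarrow> 'b) \<Rightarrow> 'g word \<Rightarrow> 'b" where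
  "word_value H f [] = \<one>\<^bsub>H\<^esub>"
| "word_value H f ((x, b) # w) = (if b then f x else inv\<^bsub>H\<^esub> (f x)) \<otimes>\<^bsub>H\<^esub> word_value H f w"

text \<open>The representative is arbitrary; when \<open>f\<close> respects the relations, all words
  in a class have the same value.\<close>

definition presented_lift :: "('b, 'c) monoid_scheme \<Rightarrow> ('g \<Rightarrow> 'b) \<Rightarrow> 'g word set \<Rightarrow> 'b" where
  "presented_lift H f A = word_value H f (SOME w. w \<in> A)"

lemma word_value_closed:
  assumes "group H" "f \<in> X \<rightarrow> carrier H" "w \<in> words X"
  shows "word_value H f w \<in> carrier H"
proof -
  interpret group H by fact
  show ?thesis using assms(3)
  proof (induction w)
    case (Cons a w)
    then show ?case using assms(2) by (cases a) (auto simp: Pi_iff)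
  qed simp
qed

lemma word_value_append:
  assumes "group H" "f \<in> X \<rightarrow> carrier H" "u \<in> words X" "v \<in> words X"
  shows "word_value H f (u @ v) = word_value H f u \<otimes>\<^bsub>H\<^esub> word_value H f v"
proof -
  interpret group H by fact
  note cl = word_value_closed[OF assms(1,2)]
  show ?thesis using assms(3)
  proof (induction u)
    case Nil
    then show ?case using cl[OF assms(4)] by simp
  next
    case (Cons a u)
    obtain x b where a: "a = (x, b)" by (cases a)
    have "x \<in> X" "u \<in> words X" using Cons a by auto
    then show ?case using Cons.IH cl[OF assms(4)] cl[of u] assms(2)
      by (auto simp: a m_assoc Pi_iff simp del: in_lists_conv_set)
  qed
qed

lemma word_value_cong:
  assumes "group H" "f \<in> X \<rightarrow> carrier H"
    and R: "\<And>u v. \<lbrakk>(u, v) \<in> R; u \<in> words X; v \<in> words X\<rbrakk> \<Longrightarrow> word_value H f u = word_value H f v"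
    and "(u, v) \<in> pres_rel X R"
  shows "word_value H f u = word_value H f v"
proof -
  interpret group H by fact
  show ?thesis using assms(4)
  proof (induction rule: pres_rel.induct)
    case (mult u v u' v')
    then show ?case
      using pres_rel_words[OF mult.hyps(1)] pres_rel_words[OF mult.hyps(2)]
      by (simp add: word_value_append[OF assms(1,2)] del: in_lists_conv_set)
  next
    case (cancel x b)
    then show ?case using assms(2) by (auto simp: Pi_iff)
  qed (use R in auto)
qed

text \<open>Von Dyck's theorem: an assignment of the generators that satisfies the relations extends
  to a homomorphism of the presented group.\<close>

lemma
  assumes "group H" "f \<in> X \<rightarrow> carrier H"
    and R: "\<And>u v. \<lbrakk>(u, v) \<in> R; u \<in> words X; v \<in> words X\<rbrakk> \<Longrightarrow> word_value H f u = word_value H f v"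
  shows presented_lift_class:
      "w \<in> words X \<Longrightarrow> presented_lift H f (pres_rel X R `` {w}) = word_value H f w"
    and presented_lift_hom: "presented_lift H f \<in> hom (presented_group X R) H"
proof -
  show lift: "presented_lift H f (pres_rel X R `` {w}) = word_value H f w"
    if "w \<in> words X" for w
  proof -
    have "w \<in> pres_rel X R `` {w}" using pres_rel.refl[OF that] by blast
    then have "(SOME v. v \<in> pres_rel X R `` {w}) \<in> pres_rel X R `` {w}" by (rule someI)
    then show ?thesis unfolding presented_lift_def
      using word_value_cong[OF assms] by (metis Image_singleton_iff)
  qed
  have rep: "\<exists>w \<in> words X. A = pres_rel X R `` {w}" if "A \<in> carrier (presented_group X R)" for A
    using that unfolding presented_group_def by (auto elim!: quotientE)
  show "presented_lift H f \<in> hom (presented_group X R) H"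
  proof (rule homI)
    fix A assume "A \<in> carrier (presented_group X R)"
    then obtain w where w: "w \<in> words X" "A = pres_rel X R `` {w}" using rep by blast
    then show "presented_lift H f A \<in> carrier H"
      using lift word_value_closed[OF assms(1,2)] by (simp del: in_lists_conv_set)
  next
    fix A B assume "A \<in> carrier (presented_group X R)" "B \<in> carrier (presented_group X R)"
    then obtain u v where uv: "u \<in> words X" "A = pres_rel X R `` {u}"
      "v \<in> words X" "B = pres_rel X R `` {v}" using rep by (metis (no_types, lifting))
    have "u @ v \<in> words X" using uv by auto
    then show "presented_lift H f (A \<otimes>\<^bsub>presented_group X R\<^esub> B) =
        presented_lift H f A \<otimes>\<^bsub>H\<^esub> presented_lift H f B"
      using uv
      by (simp add: presented_mult_class lift word_value_append[OF assms(1,2)]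
          del: in_lists_conv_set)
  qed
qed

section \<open>Conjugation and commutators\<close>

context group
begin

lemma inv_mult_cancel: "\<lbrakk>x \<in> carrier G; y \<in> carrier G\<rbrakk> \<Longrightarrow> inv x \<otimes> (x \<otimes> y) = y"
  by (simp add: m_assoc[symmetric])

lemma mult_inv_cancel: "\<lbrakk>x \<in> carrier G; y \<in> carrier G\<rbrakk> \<Longrightarrow> x \<otimes> (inv x \<otimes> y) = y"
  by (simp add: m_assoc[symmetric])

text \<open>Together with the simp rules for units and inverses, these rewrite products to reduced
  words, so that identities valid in every free group are settled by \<open>simp\<close>.\<close>

lemmas word_simps = conjugate_def commutator_def m_assoc inv_mult_group
  inv_mult_cancel mult_inv_cancel

lemma conjugate_in [simp, intro]:
  "\<lbrakk>x \<in> carrier G; y \<in> carrier G\<rbrakk> \<Longrightarrow> conjugate G x y \<in> carrier G"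
  by (simp add: conjugate_def)

lemma commutator_in [simp, intro]:
  "\<lbrakk>x \<in> carrier G; y \<in> carrier G\<rbrakk> \<Longrightarrow> commutator G x y \<in> carrier G"
  by (simp add: commutator_def)

lemma conjugate_conjugate_inv [simp]:
  "\<lbrakk>x \<in> carrier G; y \<in> carrier G\<rbrakk> \<Longrightarrow> conjugate G (conjugate G x (inv y)) y = x"
  "\<lbrakk>x \<in> carrier G; y \<in> carrier G\<rbrakk> \<Longrightarrow> conjugate G (conjugate G x y) (inv y) = x"
  by (simp_all add: word_simps)

lemma conjugate_one [simp]: "x \<in> carrier G \<Longrightarrow> conjugate G \<one> x = \<one>"
  by (simp add: word_simps)

lemma conjugate_self [simp]:
  "x \<in> carrier G \<Longrightarrow> conjugate G x x = x"
  "x \<in> carrier G \<Longrightarrow> conjugate G x (inv x) = x"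
  by (simp_all add: word_simps)

lemma conjugate_conjugate:
  "\<lbrakk>x \<in> carrier G; y \<in> carrier G; z \<in> carrier G\<rbrakk> \<Longrightarrow>
    conjugate G (conjugate G x y) z = conjugate G x (y \<otimes> z)"
  by (simp add: word_simps)

lemma conjugate_mult:
  "\<lbrakk>x \<in> carrier G; y \<in> carrier G; z \<in> carrier G\<rbrakk> \<Longrightarrow>
    conjugate G (x \<otimes> y) z = conjugate G x z \<otimes> conjugate G y z"
  by (simp add: word_simps)

lemma conjugate_inv:
  "\<lbrakk>x \<in> carrier G; z \<in> carrier G\<rbrakk> \<Longrightarrow> conjugate G (inv x) z = inv (conjugate G x z)"
  by (simp add: word_simps)

lemma conjugate_commutator:
  "\<lbrakk>x \<in> carrier G; y \<in> carrier G; z \<in> carrier G\<rbrakk> \<Longrightarrow>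
    conjugate G (commutator G x y) z = commutator G (conjugate G x z) (conjugate G y z)"
  by (simp add: word_simps)

lemma conjugate_commute:
  "\<lbrakk>x \<in> carrier G; y \<in> carrier G; x \<otimes> y = y \<otimes> x\<rbrakk> \<Longrightarrow> conjugate G x y = x"
  by (simp add: word_simps)

lemma conjugate_eq_mult_commutator:
  "\<lbrakk>x \<in> carrier G; y \<in> carrier G\<rbrakk> \<Longrightarrow> conjugate G x y = x \<otimes> commutator G x y"
  by (simp add: word_simps)

lemma commutator_eq_inv_mult_conjugate:
  "\<lbrakk>x \<in> carrier G; y \<in> carrier G\<rbrakk> \<Longrightarrow> commutator G x y = inv x \<otimes> conjugate G x y"
  by (simp add: word_simps)

lemma commutator_mult_left:
  "\<lbrakk>x \<in> carrier G; y \<in> carrier G; z \<in> carrier G\<rbrakk> \<Longrightarrow>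
    commutator G (x \<otimes> y) z = conjugate G (commutator G x z) y \<otimes> commutator G y z"
  by (simp add: word_simps)

lemma commutator_mult_right:
  "\<lbrakk>x \<in> carrier G; y \<in> carrier G; z \<in> carrier G\<rbrakk> \<Longrightarrow>
    commutator G x (y \<otimes> z) = commutator G x z \<otimes> conjugate G (commutator G x y) z"
  by (simp add: word_simps)

lemma commutator_inv_left:
  "\<lbrakk>x \<in> carrier G; z \<in> carrier G\<rbrakk> \<Longrightarrow>
    commutator G (inv x) z = conjugate G (inv (commutator G x z)) (inv x)"
  by (simp add: word_simps)

lemma inv_commutator:
  "\<lbrakk>x \<in> carrier G; y \<in> carrier G\<rbrakk> \<Longrightarrow> inv (commutator G x y) = commutator G y x"
  by (simp add: word_simps)

end

section \<open>The tensor square as a crossed module\<close>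

text \<open>The diagonal right action of the group on its tensor square.\<close>

definition tensor_act :: "('a, 'b) monoid_scheme \<Rightarrow> 'a \<Rightarrow> ('a \<times> 'a) word set \<Rightarrow> ('a \<times> 'a) word set" where
  "tensor_act G x = presented_lift (tensor_square G)
     (\<lambda>(g, h). tensor G (conjugate G g x) (conjugate G h x))"

text \<open>The boundary map of the crossed module.\<close>

definition tensor_commutator :: "('a, 'b) monoid_scheme \<Rightarrow> ('a \<times> 'a) word set \<Rightarrow> 'a" where
  "tensor_commutator G = presented_lift G (\<lambda>(g, h). commutator G g h)"

locale tensor_group = group G + T: group "tensor_square G" for G (structure)
begin

abbreviation (input) T where "T \<equiv> tensor_square G"

abbreviation tens (infixl "\<odot>" 75) where "g \<odot> h \<equiv> tensor G g h"

lemma tens_in [simp, intro]: "\<lbrakk>g \<in> carrier G; h \<in> carrier G\<rbrakk> \<Longrightarrow> g \<odot> h \<in> carrier T"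
  by (rule tensor_closed)

lemma tensor_relation_word:
  assumes "group H" "f \<in> carrier G \<times> carrier G \<rightarrow> carrier H"
    and "\<And>g g' h. \<lbrakk>g \<in> carrier G; g' \<in> carrier G; h \<in> carrier G\<rbrakk> \<Longrightarrow>
      f (g \<otimes> g', h) = f (conjugate G g g', conjugate G h g') \<otimes>\<^bsub>H\<^esub> f (g', h)"
    and "\<And>g h h'. \<lbrakk>g \<in> carrier G; h \<in> carrier G; h' \<in> carrier G\<rbrakk> \<Longrightarrow>
      f (g, h \<otimes> h') = f (g, h') \<otimes>\<^bsub>H\<^esub> f (conjugate G g h', conjugate G h h')"
    and "(u, v) \<in> tensor_relations G"
  shows "word_value H f u = word_value H f v"
proof -
  interpret H: group H by fact
  have f: "f (x, y) \<in> carrier H" if "x \<in> carrier G" "y \<in> carrier G" for x y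
    using assms(2) that by auto
  show ?thesis
    using assms(5) unfolding tensor_relations_def
    by (auto simp: f assms(3,4) H.m_closed)
qed

text \<open>Both families of relations are preserved because conjugation by \<open>x\<close> is an
  endomorphism, and hence is compatible with the conjugations inside the relations
  (\<open>eq\<close>).\<close>

lemma
  assumes "x \<in> carrier G"
  shows tensor_act_hom: "tensor_act G x \<in> hom T T"
    and tensor_act_tensor [simp]: "\<lbrakk>g \<in> carrier G; h \<in> carrier G\<rbrakk> \<Longrightarrow>
      tensor_act G x (g \<odot> h) = conjugate G g x \<odot> conjugate G h x"
proof -
  let ?f = "\<lambda>(g, h). conjugate G g x \<odot> conjugate G h x"
  have f: "?f \<in> carrier G \<times> carrier G \<rightarrow> carrier T"
    using assms by auto
  have eq: "conjugate G (conjugate G g g') x = conjugate G (conjugate G g x) (conjugate G g' x)"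
    if "g \<in> carrier G" "g' \<in> carrier G" for g g'
    using that assms by (simp add: word_simps)
  have rel: "word_value T ?f u = word_value T ?f v" if "(u, v) \<in> tensor_relations G" for u v
    using assms
    by (intro tensor_relation_word[OF group_tensor_square f _ _ that])
      (simp_all add: conjugate_mult tensor_mult_left[OF is_group] tensor_mult_right[OF is_group] eq)
  show "tensor_act G x \<in> hom T T"
    unfolding tensor_act_def
    using presented_lift_hom[OF group_tensor_square f rel] by (simp only: tensor_square_def)
  show "tensor_act G x (g \<odot> h) = conjugate G g x \<odot> conjugate G h x"
    if "g \<in> carrier G" "h \<in> carrier G"
    unfolding tensor_act_def tensor_def[of G g h]
    using presented_lift_class[OF group_tensor_square f rel, where w = "[((g, h), True)]"] that assms
    by simp
qed

text \<open>The defining relations are modelled on the expansions of \<open>[g g', h]\<close> and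
  \<open>[g, h h']\<close>, so commutators satisfy them.\<close>

lemma
  shows tensor_commutator_hom: "tensor_commutator G \<in> hom T G"
    and tensor_commutator_tensor [simp]: "\<lbrakk>g \<in> carrier G; h \<in> carrier G\<rbrakk> \<Longrightarrow>
      tensor_commutator G (g \<odot> h) = commutator G g h"
proof -
  let ?f = "\<lambda>(g, h). commutator G g h"
  have f: "?f \<in> carrier G \<times> carrier G \<rightarrow> carrier G"
    by auto
  have rel: "word_value G ?f u = word_value G ?f v" if "(u, v) \<in> tensor_relations G" for u v
    by (intro tensor_relation_word[OF is_group f _ _ that])
      (simp_all add: commutator_mult_left commutator_mult_right conjugate_commutator)
  show "tensor_commutator G \<in> hom T G"
    unfolding tensor_commutator_def tensor_square_def
    by (rule presented_lift_hom[OF is_group f rel])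
  show "tensor_commutator G (g \<odot> h) = commutator G g h"
    if "g \<in> carrier G" "h \<in> carrier G"
    unfolding tensor_commutator_def tensor_def
    using presented_lift_class[OF is_group f rel, where w = "[((g, h), True)]"] that
    by simp
qed

lemma tensor_act_mult:
  "\<lbrakk>x \<in> carrier G; s \<in> carrier T; t \<in> carrier T\<rbrakk> \<Longrightarrow>
    tensor_act G x (s \<otimes>\<^bsub>T\<^esub> t) = tensor_act G x s \<otimes>\<^bsub>T\<^esub> tensor_act G x t"
  using tensor_act_hom by (simp add: hom_mult)

lemma tensor_act_one: "x \<in> carrier G \<Longrightarrow> tensor_act G x \<one>\<^bsub>T\<^esub> = \<one>\<^bsub>T\<^esub>"
  using tensor_act_hom hom_one group_tensor_square by blast

lemma tensor_commutator_mult: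
  "\<lbrakk>s \<in> carrier T; t \<in> carrier T\<rbrakk> \<Longrightarrow>
    tensor_commutator G (s \<otimes>\<^bsub>T\<^esub> t) = tensor_commutator G s \<otimes> tensor_commutator G t"
  using tensor_commutator_hom by (simp add: hom_mult)

lemma tensor_commutator_one: "tensor_commutator G \<one>\<^bsub>T\<^esub> = \<one>"
  using tensor_commutator_hom hom_one group_tensor_square is_group by blast

section \<open>Crossed module identities for simple tensors\<close>

lemma tensor_one_left [simp]:
  assumes "h \<in> carrier G"
  shows "\<one> \<odot> h = \<one>\<^bsub>T\<^esub>"
proof -
  have "\<one> \<odot> h = \<one> \<odot> h \<otimes>\<^bsub>T\<^esub> \<one> \<odot> h"
    using tensor_mult_left[OF is_group, of \<one> \<one> h] assms by (simp add: conjugate_def)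
  then show ?thesis using assms by (simp add: T.r_cancel_one')
qed

text \<open>Expand \<open>gg' \<odot> hh'\<close> in the two possible ways.\<close>

lemma tensor_conjugate_swap:
  assumes "g \<in> carrier G" "g' \<in> carrier G" "h \<in> carrier G" "h' \<in> carrier G"
  shows "g' \<odot> h' \<otimes>\<^bsub>T\<^esub> conjugate G g (g' \<otimes> h') \<odot> conjugate G h (g' \<otimes> h') =
    conjugate G g (h' \<otimes> g') \<odot> conjugate G h (h' \<otimes> g') \<otimes>\<^bsub>T\<^esub> g' \<odot> h'" (is "?u \<otimes>\<^bsub>T\<^esub> ?a = ?b \<otimes>\<^bsub>T\<^esub> ?u")
proof -
  let ?l = "conjugate G g g' \<odot> conjugate G h' g'"
  let ?r = "conjugate G g' h' \<odot> conjugate G h h'"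
  note cl = assms tens_in m_closed inv_closed conjugate_in
  have c: "conjugate G (conjugate G x g') (conjugate G y g') = conjugate G (conjugate G x y) g'"
    if "x \<in> carrier G" "y \<in> carrier G" for x y
    using that assms by (simp add: word_simps)
  have c': "conjugate G (conjugate G x h') (conjugate G g' h') = conjugate G x (g' \<otimes> h')"
    if "x \<in> carrier G" for x
    using that assms by (simp add: word_simps)
  have hg: "g' \<otimes> conjugate G h' g' = h' \<otimes> g'"
    using assms by (simp add: word_simps)
  have "(g \<otimes> g') \<odot> (h \<otimes> h') = (?l \<otimes>\<^bsub>T\<^esub> ?u) \<otimes>\<^bsub>T\<^esub> (?a \<otimes>\<^bsub>T\<^esub> ?r)"
    using assms
    by (subst tensor_mult_right)
      (simp_all add: is_group tensor_mult_left conjugate_mult c')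
  moreover have "(g \<otimes> g') \<odot> (h \<otimes> h') = (?l \<otimes>\<^bsub>T\<^esub> ?b) \<otimes>\<^bsub>T\<^esub> (?u \<otimes>\<^bsub>T\<^esub> ?r)"
    using assms
    by (subst tensor_mult_left)
      (simp_all add: is_group tensor_mult_right conjugate_mult c conjugate_conjugate hg)
  \<comment> \<open>Both expansions begin with \<open>?l\<close> and end with \<open>?r\<close>;
    cancelling these leaves the claim.\<close>
  ultimately have "?l \<otimes>\<^bsub>T\<^esub> ((?u \<otimes>\<^bsub>T\<^esub> ?a) \<otimes>\<^bsub>T\<^esub> ?r) = ?l \<otimes>\<^bsub>T\<^esub> ((?b \<otimes>\<^bsub>T\<^esub> ?u) \<otimes>\<^bsub>T\<^esub> ?r)"
    using cl by (simp add: T.m_assoc)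
  then show ?thesis using cl by simp
qed

text \<open>The Peiffer identity on generators: conjugating by a tensor is acting by its boundary.
  It is \<open>tensor_conjugate_swap\<close> shifted by the inverse of \<open>h' g'\<close>, since
  that inverse times \<open>g' h'\<close> is \<open>[g', h']\<close>.\<close>

lemma tensor_act_commutator:
  assumes "g \<in> carrier G" "g' \<in> carrier G" "h \<in> carrier G" "h' \<in> carrier G"
  shows "g' \<odot> h' \<otimes>\<^bsub>T\<^esub> tensor_act G (commutator G g' h') (g \<odot> h) = g \<odot> h \<otimes>\<^bsub>T\<^esub> g' \<odot> h'"
proof -
  let ?k = "inv (h' \<otimes> g')"
  have e: "conjugate G (conjugate G x ?k) (g' \<otimes> h') = conjugate G x (commutator G g' h')"
    if "x \<in> carrier G" for x
    using that assms by (simp add: word_simps)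
  have e': "conjugate G (conjugate G x ?k) (h' \<otimes> g') = x" if "x \<in> carrier G" for x
    using that assms by simp
  show ?thesis
    using tensor_conjugate_swap[of "conjugate G g ?k" g' "conjugate G h ?k" h'] assms
    by (simp add: e e' del: conjugate_conjugate_inv)
qed

text \<open>This mirrors \<open>t^w = t [t, w]\<close> for a commutator \<open>t\<close> in a
  covering group. The proof splits \<open>[g, h]\<close> as the inverse of \<open>g\<close> times
  the conjugate of \<open>g\<close> by \<open>h\<close> and expands the tensor with
  \<open>w\<close>.\<close>

lemma tensor_commutator_left:
  assumes "g \<in> carrier G" "h \<in> carrier G" "w \<in> carrier G"
  shows "tensor_act G w (g \<odot> h) = g \<odot> h \<otimes>\<^bsub>T\<^esub> commutator G g h \<odot> w"
proof -
  let ?c = "commutator G g h"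
  let ?s = "conjugate G (inv g) (conjugate G g h) \<odot> conjugate G w (conjugate G g h)"
  have c: "inv g \<otimes> conjugate G g h = ?c"
    using assms by (simp add: word_simps)
  have split: "?c \<odot> w = ?s \<otimes>\<^bsub>T\<^esub> conjugate G g h \<odot> w"
    using tensor_mult_left[OF is_group, of "inv g" "conjugate G g h" w] assms c by simp
  \<comment> \<open>Acting by \<open>?c\<close> on the expansion of the trivial tensor of
    \<open>inv g \<otimes> g\<close> with \<open>w\<close> identifies \<open>?s\<close> as an
    inverse; the Peiffer identity then evaluates that inverse.\<close>
  have "conjugate G (inv g) g \<odot> conjugate G w g \<otimes>\<^bsub>T\<^esub> g \<odot> w = \<one>\<^bsub>T\<^esub>"
    using tensor_mult_left[OF is_group, of "inv g" g w] assms by simp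
  then have "tensor_act G ?c (conjugate G (inv g) g \<odot> conjugate G w g \<otimes>\<^bsub>T\<^esub> g \<odot> w) = \<one>\<^bsub>T\<^esub>"
    using assms by (simp add: tensor_act_one)
  moreover have "conjugate G (conjugate G x g) ?c = conjugate G x (conjugate G g h)"
    if "x \<in> carrier G" for x
    using that assms by (simp add: word_simps)
  ultimately have s: "?s \<otimes>\<^bsub>T\<^esub> tensor_act G ?c (g \<odot> w) = \<one>\<^bsub>T\<^esub>"
    using assms by (simp add: tensor_act_mult)
  have cl: "?s \<in> carrier T" "tensor_act G ?c (g \<odot> w) \<in> carrier T"
    "g \<odot> h \<in> carrier T" "g \<odot> w \<in> carrier T" "conjugate G g h \<odot> w \<in> carrier T"
    "conjugate G g w \<odot> conjugate G h w \<in> carrier T"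
    using assms by auto
  have "?s = inv\<^bsub>T\<^esub> (tensor_act G ?c (g \<odot> w))"
    using s cl by (metis T.inv_equality)
  moreover have "tensor_act G ?c (g \<odot> w) = inv\<^bsub>T\<^esub> (g \<odot> h) \<otimes>\<^bsub>T\<^esub> (g \<odot> w \<otimes>\<^bsub>T\<^esub> g \<odot> h)"
    using tensor_act_commutator[of g g w h] assms cl
    by (metis T.inv_mult_cancel)
  ultimately have s_eq: "g \<odot> h \<otimes>\<^bsub>T\<^esub> ?s = inv\<^bsub>T\<^esub> (g \<odot> w) \<otimes>\<^bsub>T\<^esub> g \<odot> h"
    using cl by (simp add: T.inv_mult_group T.m_assoc T.mult_inv_cancel)
  \<comment> \<open>The second factor \<open>h w\<close> is read both as a product of
    \<open>h\<close> and \<open>w\<close>, and as a conjugate of \<open>w\<close> followed by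
    \<open>h\<close>.\<close>
  have "conjugate G w (inv h) \<otimes> h = h \<otimes> w"
    using assms by (simp add: word_simps)
  then have "g \<odot> h \<otimes>\<^bsub>T\<^esub> conjugate G g h \<odot> w = g \<odot> (h \<otimes> w)"
    using tensor_mult_right[OF is_group, of g "conjugate G w (inv h)" h] assms by simp
  also have "\<dots> = g \<odot> w \<otimes>\<^bsub>T\<^esub> conjugate G g w \<odot> conjugate G h w"
    using tensor_mult_right[OF is_group] assms by simp
  finally have p: "g \<odot> h \<otimes>\<^bsub>T\<^esub> conjugate G g h \<odot> w =
      g \<odot> w \<otimes>\<^bsub>T\<^esub> conjugate G g w \<odot> conjugate G h w" .
  have "g \<odot> h \<otimes>\<^bsub>T\<^esub> ?c \<odot> w = (g \<odot> h \<otimes>\<^bsub>T\<^esub> ?s) \<otimes>\<^bsub>T\<^esub> conjugate G g h \<odot> w"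
    using cl split by (simp add: T.m_assoc)
  also have "\<dots> = inv\<^bsub>T\<^esub> (g \<odot> w) \<otimes>\<^bsub>T\<^esub> (g \<odot> h \<otimes>\<^bsub>T\<^esub> conjugate G g h \<odot> w)"
    using cl s_eq by (simp add: T.m_assoc)
  also have "\<dots> = conjugate G g w \<odot> conjugate G h w"
    using cl p by (simp add: T.inv_mult_cancel)
  finally show ?thesis using assms by simp
qed

end

section \<open>Groups with trivial diagonal tensors\<close>

text \<open>
  The tensor square is now the exterior square, i.e. the commutator subgroup of a
  covering group of \<open>G\<close>, and \<open>perp u v\<close> says that lifts of \<open>u\<close> and \<open>v\<close> to that cover commute.
\<close>

locale exterior_group = tensor_group +
  assumes tensor_self [simp]: "x \<in> carrier G \<Longrightarrow> x \<odot> x = \<one>\<^bsub>T\<^esub>"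
begin

definition perp :: "'a \<Rightarrow> 'a \<Rightarrow> bool" where
  "perp u v \<longleftrightarrow> u \<in> carrier G \<and> v \<in> carrier G \<and> u \<odot> v = \<one>\<^bsub>T\<^esub>"

lemma perp_in: "perp u v \<Longrightarrow> u \<in> carrier G" "perp u v \<Longrightarrow> v \<in> carrier G"
  by (simp_all add: perp_def)

lemma perp_self: "u \<in> carrier G \<Longrightarrow> perp u u"
  by (simp add: perp_def)

lemma perp_one_left: "u \<in> carrier G \<Longrightarrow> perp \<one> u"
  by (simp add: perp_def)

lemma tensor_mult_left_act:
  "\<lbrakk>u \<in> carrier G; v \<in> carrier G; w \<in> carrier G\<rbrakk> \<Longrightarrow>
    (u \<otimes> v) \<odot> w = tensor_act G v (u \<odot> w) \<otimes>\<^bsub>T\<^esub> v \<odot> w"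
  by (simp add: tensor_mult_left[OF is_group])

lemma tensor_mult_right_act:
  "\<lbrakk>u \<in> carrier G; v \<in> carrier G; w \<in> carrier G\<rbrakk> \<Longrightarrow>
    u \<odot> (v \<otimes> w) = u \<odot> w \<otimes>\<^bsub>T\<^esub> tensor_act G w (u \<odot> v)"
  by (simp add: tensor_mult_right[OF is_group])

text \<open>Expand the diagonal tensor of \<open>y x\<close>, written as
  \<open>?x \<otimes> y\<close>. Two of the four resulting factors are diagonal themselves and
  vanish.\<close>

lemma tensor_mult_swap:
  assumes "x \<in> carrier G" "y \<in> carrier G"
  shows "x \<odot> y \<otimes>\<^bsub>T\<^esub> y \<odot> x = \<one>\<^bsub>T\<^esub>"
proof -
  let ?x = "conjugate G x (inv y)"
  have "\<one>\<^bsub>T\<^esub> = (?x \<otimes> y) \<odot> (?x \<otimes> y)"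
    using assms by simp
  also have "\<dots> = x \<odot> y \<otimes>\<^bsub>T\<^esub> y \<odot> x"
    using assms
    by (subst tensor_mult_left) (simp_all add: is_group tensor_mult_right conjugate_mult)
  finally show ?thesis ..
qed

lemma perp_sym: "perp u v \<Longrightarrow> perp v u"
  using tensor_mult_swap[of u v] by (simp add: perp_def)

lemma perp_conjugate: "\<lbrakk>perp u v; x \<in> carrier G\<rbrakk> \<Longrightarrow> perp (conjugate G u x) (conjugate G v x)"
  unfolding perp_def by (metis conjugate_in tensor_act_one tensor_act_tensor)

lemma perp_mult_left: "\<lbrakk>perp u w; perp v w\<rbrakk> \<Longrightarrow> perp (u \<otimes> v) w"
  unfolding perp_def using tensor_mult_left_act[of u v w] by (simp add: tensor_act_one)

lemma perp_inv_left:
  assumes "perp u w"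
  shows "perp (inv u) w"
proof -
  have [simp]: "u \<in> carrier G" "w \<in> carrier G" using assms by (simp_all add: perp_def)
  \<comment> \<open>Expanding the tensor of \<open>inv u \<otimes> u\<close> with \<open>w\<close>
    leaves a relation conjugated by \<open>u\<close>, which conjugation by \<open>inv u\<close>
    undoes.\<close>
  have "perp (conjugate G (inv u) u) (conjugate G w u)"
    using tensor_mult_left_act[of "inv u" u w, symmetric] assms by (simp add: perp_def)
  from perp_conjugate[OF this, of "inv u"] show ?thesis by simp
qed

text \<open>The boundary map sends \<open>u \<odot> v\<close> to \<open>[u, v]\<close>, so
  \<open>perp\<close> refines commuting in the group.\<close>

lemma perp_commute:
  assumes "perp u v"
  shows "u \<otimes> v = v \<otimes> u"
proof -
  have cl: "u \<in> carrier G" "v \<in> carrier G" using assms by (simp_all add: perp_def)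
  then have "commutator G u v = \<one>"
    using assms tensor_commutator_tensor[of u v] tensor_commutator_one by (simp add: perp_def)
  then have "v \<otimes> (u \<otimes> commutator G u v) = v \<otimes> u" using cl by simp
  then show ?thesis using cl by (simp add: word_simps)
qed

lemma perp_conjugate_eq: "perp u v \<Longrightarrow> conjugate G u v = u"
  by (intro conjugate_commute perp_commute perp_in)

lemma tensor_act_perp:
  "\<lbrakk>u \<in> carrier G; z \<in> carrier G; perp (commutator G u z) w\<rbrakk> \<Longrightarrow> tensor_act G w (u \<odot> z) = u \<odot> z"
  using tensor_commutator_left[of u z w] by (simp add: perp_def)

text \<open>Elements perpendicular to a fixed one are closed under products and inverses. One
  induction treats each argument, with \<open>perp_sym\<close> in between.\<close>

lemma generate_perp:
  assumes "\<And>s t. \<lbrakk>s \<in> S; t \<in> S'\<rbrakk> \<Longrightarrow> perp s t" "S \<subseteq> carrier G" "S' \<subseteq> carrier G"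
    and "u \<in> generate G S" "v \<in> generate G S'"
  shows "perp u v"
proof -
  have "perp u t" if t: "t \<in> S'" for t
    using assms(4)
    by (induction rule: generate.induct)
      (use assms(1-3) t in \<open>auto intro: perp_one_left perp_inv_left perp_mult_left\<close>)
  with assms(5) have "perp v u"
    by (induction rule: generate.induct)
      (use generate_in_carrier[OF assms(2,4)] in
        \<open>auto intro: perp_one_left perp_inv_left perp_mult_left perp_sym\<close>)
  then show ?thesis by (rule perp_sym)
qed

section \<open>The normal closure of a right 2-tensor-Engel element\<close>

lemma engel_iff:
  "a \<in> right_2_tensor_engel G \<longleftrightarrow>
    a \<in> carrier G \<and> (\<forall>x \<in> carrier G. perp (commutator G a x) x)"
  by (auto simp: right_2_tensor_engel_def perp_def)

lemma engel_in: "a \<in> right_2_tensor_engel G \<Longrightarrow> a \<in> carrier G"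
  by (simp add: engel_iff)

lemma engel_perp:
  "\<lbrakk>a \<in> right_2_tensor_engel G; x \<in> carrier G\<rbrakk> \<Longrightarrow> perp (commutator G a x) x"
  by (simp add: engel_iff)

text \<open>Conjugation by \<open>y\<close> merely permutes the test elements
  \<open>x\<close>.\<close>

lemma engel_conjugate:
  assumes "a \<in> right_2_tensor_engel G" "y \<in> carrier G"
  shows "conjugate G a y \<in> right_2_tensor_engel G"
proof -
  have "perp (commutator G (conjugate G a y) x) x" if "x \<in> carrier G" for x
    using perp_conjugate[OF engel_perp[OF assms(1), of "conjugate G x (inv y)"] assms(2)]
      that assms by (simp add: conjugate_commutator engel_in)
  then show ?thesis using assms by (simp add: engel_iff)
qed

text \<open>Since \<open>[a, xa] = [a, x]\<^sup>a\<close>, the hypothesis for \<open>xa\<close> shows \<open>perp [a, x] (ax)\<close>.\<close>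

lemma engel_perp_self:
  assumes a: "a \<in> right_2_tensor_engel G" and x: "x \<in> carrier G"
  shows "perp (commutator G a x) a"
proof -
  note [simp] = engel_in[OF a] x
  have "commutator G a (x \<otimes> a) = conjugate G (commutator G a x) a"
    by (simp add: word_simps)
  with engel_perp[OF a, of "x \<otimes> a"]
  have "perp (conjugate G (commutator G a x) a) (x \<otimes> a)" by simp
  from perp_conjugate[OF this, of "inv a"]
  have "perp (commutator G a x) (conjugate G (x \<otimes> a) (inv a))" by simp
  moreover have "conjugate G (x \<otimes> a) (inv a) \<otimes> inv x = a"
    by (simp add: word_simps)
  ultimately show ?thesis
    using engel_perp[OF a x] by (metis perp_sym perp_mult_left perp_inv_left)
qed

text \<open>Up to conjugation by \<open>y\<close> the second element is \<open>a\<close> itself, and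
  the first is then \<open>a [a, z]\<close> with \<open>z = x \<otimes> inv y\<close>.\<close>

lemma engel_conjugates_perp:
  assumes a: "a \<in> right_2_tensor_engel G" and "x \<in> carrier G" "y \<in> carrier G"
  shows "perp (conjugate G a x) (conjugate G a y)"
proof -
  note [simp] = engel_in[OF a] assms(2,3)
  have "perp (conjugate G a (x \<otimes> inv y)) a"
    by (subst conjugate_eq_mult_commutator)
      (simp_all add: perp_mult_left perp_self engel_perp_self[OF a])
  from perp_conjugate[OF this, of y] show ?thesis
    by (simp add: conjugate_conjugate m_assoc)
qed

definition normal_closure :: "'a \<Rightarrow> 'a set" where
  "normal_closure a = generate G (conjugate G a ` carrier G)"

context
  fixes a
  assumes a: "a \<in> right_2_tensor_engel G"
begin

lemma conjugates_carrier: "conjugate G a ` carrier G \<subseteq> carrier G"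
  using engel_in[OF a] by auto

lemma nc_in: "u \<in> normal_closure a \<Longrightarrow> u \<in> carrier G"
  unfolding normal_closure_def by (rule generate_in_carrier[OF conjugates_carrier])

text \<open>The normal closure is abelian even after lifting to the cover; this makes the commutator
  and tensor maps below additive.\<close>

lemma nc_perp: "\<lbrakk>u \<in> normal_closure a; v \<in> normal_closure a\<rbrakk> \<Longrightarrow> perp u v"
  unfolding normal_closure_def
  by (rule generate_perp[OF _ conjugates_carrier conjugates_carrier])
    (auto intro: engel_conjugates_perp[OF a])

lemma nc_mult:
  "\<lbrakk>u \<in> normal_closure a; v \<in> normal_closure a\<rbrakk> \<Longrightarrow> u \<otimes> v \<in> normal_closure a"
  unfolding normal_closure_def by (rule generate.eng)

lemma nc_inv: "u \<in> normal_closure a \<Longrightarrow> inv u \<in> normal_closure a"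
  unfolding normal_closure_def by (rule generate_m_inv_closed[OF conjugates_carrier])

lemma nc_conjugate_self: "x \<in> carrier G \<Longrightarrow> conjugate G a x \<in> normal_closure a"
  unfolding normal_closure_def by (auto intro: generate.incl)

lemma nc_self: "a \<in> normal_closure a"
  using nc_conjugate_self[of \<one>] engel_in[OF a] by (simp add: word_simps)

lemma nc_conjugate:
  assumes "u \<in> normal_closure a" "x \<in> carrier G"
  shows "conjugate G u x \<in> normal_closure a"
  using assms(1) unfolding normal_closure_def
proof (induction rule: generate.induct)
  case one
  show ?case using assms(2) by (simp add: generate.one)
next
  case (incl h)
  then show ?case
    using assms(2) engel_in[OF a] by (auto simp: conjugate_conjugate intro!: generate.incl)
next
  case (inv h)
  then show ?case
    using assms(2) engel_in[OF a]
    by (auto simp: conjugate_conjugate conjugate_inv intro!: generate.inv)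
next
  case (eng u v)
  then show ?case
    using assms(2) generate_in_carrier[OF conjugates_carrier]
    by (simp add: conjugate_mult generate.eng)
qed

lemma nc_commutator:
  "\<lbrakk>u \<in> normal_closure a; x \<in> carrier G\<rbrakk> \<Longrightarrow> commutator G u x \<in> normal_closure a"
  by (simp add: commutator_eq_inv_mult_conjugate nc_in nc_mult nc_inv nc_conjugate)

lemmas nc_closed = nc_in nc_mult nc_inv nc_conjugate_self nc_self nc_conjugate nc_commutator

lemma nc_commute: "\<lbrakk>u \<in> normal_closure a; v \<in> normal_closure a\<rbrakk> \<Longrightarrow> u \<otimes> v = v \<otimes> u"
  by (rule perp_commute[OF nc_perp])

lemma nc_left_commute:
  "\<lbrakk>u \<in> normal_closure a; v \<in> normal_closure a; w \<in> normal_closure a\<rbrakk> \<Longrightarrow>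
    u \<otimes> (v \<otimes> w) = v \<otimes> (u \<otimes> w)"
  by (metis m_assoc nc_commute nc_in)

lemma nc_commutator_mult:
  "\<lbrakk>u \<in> normal_closure a; v \<in> normal_closure a; z \<in> carrier G\<rbrakk> \<Longrightarrow>
    commutator G (u \<otimes> v) z = commutator G u z \<otimes> commutator G v z"
  by (simp add: commutator_mult_left perp_conjugate_eq nc_perp nc_in nc_commutator)

lemma nc_commutator_inv:
  "\<lbrakk>u \<in> normal_closure a; z \<in> carrier G\<rbrakk> \<Longrightarrow>
    commutator G (inv u) z = inv (commutator G u z)"
  by (simp add: commutator_inv_left conjugate_inv perp_conjugate_eq nc_perp nc_in nc_commutator nc_inv)

text \<open>Conjugates of \<open>a\<close> are Engel, and \<open>[u, x]\<close> is multiplicative in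
  \<open>u\<close> on the normal closure. Results about \<open>a\<close> thus apply to
  \<open>[a, x]\<close> as well.\<close>

lemma nc_engel:
  assumes "u \<in> normal_closure a"
  shows "u \<in> right_2_tensor_engel G"
proof -
  have "perp (commutator G u x) x" if x: "x \<in> carrier G" for x
    using assms unfolding normal_closure_def
  proof (induction rule: generate.induct)
    case one
    have "commutator G \<one> x = \<one>" using x by (simp add: word_simps)
    then show ?case using x by (simp add: perp_one_left)
  next
    case (incl h)
    then show ?case using engel_perp[OF engel_conjugate[OF a] x] by auto
  next
    case (inv h)
    then have h: "h \<in> normal_closure a" "perp (commutator G h x) x"
      using nc_conjugate_self engel_perp[OF engel_conjugate[OF a] x] by auto
    then show ?case using x by (simp add: nc_commutator_inv perp_inv_left)
  next
    case (eng u v)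
    then show ?case
      using x nc_commutator_mult[of u v x] by (simp add: normal_closure_def perp_mult_left)
  qed
  then show ?thesis using assms by (simp add: engel_iff nc_in)
qed

lemma nc_tensor_mult:
  assumes "u \<in> normal_closure a" "v \<in> normal_closure a" "z \<in> carrier G"
  shows "(u \<otimes> v) \<odot> z = u \<odot> z \<otimes>\<^bsub>T\<^esub> v \<odot> z"
proof -
  have "tensor_act G v (u \<odot> z) = u \<odot> z"
    using assms by (intro tensor_act_perp nc_perp) (simp_all add: nc_closed)
  then show ?thesis using assms tensor_mult_left_act[of u v z] by (simp add: nc_in)
qed

text \<open>By the Peiffer identity, conjugation by \<open>u \<odot> z\<close> is the action of
  \<open>[u, z]\<close>; this is trivial on \<open>v \<odot> w\<close> because \<open>[v, w]\<close>
  is perpendicular to \<open>[u, z]\<close>.\<close>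

lemma nc_tensor_commute:
  assumes "u \<in> normal_closure a" "v \<in> normal_closure a" "z \<in> carrier G" "w \<in> carrier G"
  shows "u \<odot> z \<otimes>\<^bsub>T\<^esub> v \<odot> w = v \<odot> w \<otimes>\<^bsub>T\<^esub> u \<odot> z"
proof -
  have "tensor_act G (commutator G u z) (v \<odot> w) = v \<odot> w"
    using assms by (intro tensor_act_perp nc_perp) (simp_all add: nc_closed)
  then show ?thesis using assms tensor_act_commutator[of v u w z] by (simp add: nc_in)
qed

lemma nc_tensor_left_commute:
  assumes "u \<in> normal_closure a" "v \<in> normal_closure a" "z \<in> carrier G" "w \<in> carrier G"
    and "t \<in> carrier T"
  shows "u \<odot> z \<otimes>\<^bsub>T\<^esub> (v \<odot> w \<otimes>\<^bsub>T\<^esub> t) = v \<odot> w \<otimes>\<^bsub>T\<^esub> (u \<odot> z \<otimes>\<^bsub>T\<^esub> t)"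
  using nc_tensor_commute[OF assms(1-4)] assms by (metis T.m_assoc nc_in tens_in)

section \<open>Commutator identities for right 2-tensor-Engel elements\<close>

text \<open>Expand \<open>[a, xy] \<odot> xy = 1\<close>.\<close>

lemma engel_linearize:
  assumes [simp]: "x \<in> carrier G" "y \<in> carrier G"
  defines "p \<equiv> commutator G a x" and "q \<equiv> commutator G a y"
  shows "q \<odot> x \<otimes>\<^bsub>T\<^esub> (p \<odot> y \<otimes>\<^bsub>T\<^esub> commutator G p y \<odot> x) = \<one>\<^bsub>T\<^esub>"
proof -
  note [simp] = engel_in[OF a] nc_closed
  have pq [simp]: "p \<in> normal_closure a" "q \<in> normal_closure a" "p \<odot> x = \<one>\<^bsub>T\<^esub>" "q \<odot> y = \<one>\<^bsub>T\<^esub>"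
    using engel_perp[OF a] by (simp_all add: p_def q_def perp_def)
  have [simp]: "p \<in> carrier G" "q \<in> carrier G" by simp_all
  have "(p \<otimes> commutator G p y) \<odot> x = commutator G p y \<odot> x"
    by (subst nc_tensor_mult) simp_all
  then have px: "conjugate G p y \<odot> x = commutator G p y \<odot> x"
    by (simp add: conjugate_eq_mult_commutator)
  have "commutator G a (x \<otimes> y) = q \<otimes> conjugate G p y"
    by (simp add: p_def q_def commutator_mult_right)
  then have "\<one>\<^bsub>T\<^esub> = (q \<otimes> conjugate G p y) \<odot> (x \<otimes> y)"
    using engel_perp[OF a, of "x \<otimes> y"] by (simp add: perp_def)
  also have "\<dots> = q \<odot> (x \<otimes> y) \<otimes>\<^bsub>T\<^esub> conjugate G p y \<odot> (x \<otimes> y)"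
    by (simp add: nc_tensor_mult)
  also have "q \<odot> (x \<otimes> y) = tensor_act G y (q \<odot> x)"
    by (simp add: tensor_mult_right_act)
  also have "conjugate G p y \<odot> (x \<otimes> y) = conjugate G p y \<odot> y \<otimes>\<^bsub>T\<^esub> tensor_act G y (conjugate G p y \<odot> x)"
    by (simp add: tensor_mult_right_act)
  also have "conjugate G p y \<odot> y = tensor_act G y (p \<odot> y)"
    by simp
  \<comment> \<open>Every remaining factor carries the action of \<open>y\<close>, so acting by
    \<open>inv y\<close> removes it throughout.\<close>
  finally have "tensor_act G (inv y) (tensor_act G y (q \<odot> x) \<otimes>\<^bsub>T\<^esub>
      (tensor_act G y (p \<odot> y) \<otimes>\<^bsub>T\<^esub> tensor_act G y (conjugate G p y \<odot> x))) = \<one>\<^bsub>T\<^esub>"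
    by (metis inv_closed assms(2) tensor_act_one)
  then show ?thesis by (simp add: tensor_act_mult px)
qed

text \<open>The boundary of \<open>engel_linearize\<close> reads \<open>[q, x] r [r, x] = 1\<close>.
  Solved for the middle \<open>r\<close>, it is a product of inverses of two commutators with
  \<open>x\<close> of Engel elements, each perpendicular to \<open>x\<close>.\<close>

lemma engel_perp_first:
  assumes [simp]: "x \<in> carrier G" "y \<in> carrier G"
  shows "perp (commutator G (commutator G a x) y) x"
proof -
  note [simp] = nc_closed
  define p where "p = commutator G a x"
  define q where "q = commutator G a y"
  define r where "r = commutator G p y"
  have [simp]: "p \<in> normal_closure a" "q \<in> normal_closure a" "r \<in> normal_closure a"
    by (simp_all add: p_def q_def r_def)
  have [simp]: "p \<in> carrier G" "q \<in> carrier G" "r \<in> carrier G" by simp_all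
  have "tensor_commutator G (q \<odot> x \<otimes>\<^bsub>T\<^esub> (p \<odot> y \<otimes>\<^bsub>T\<^esub> r \<odot> x)) = \<one>"
    using engel_linearize[OF assms] by (simp add: p_def q_def r_def tensor_commutator_one)
  then have "commutator G q x \<otimes> (r \<otimes> commutator G r x) = \<one>"
    by (simp add: tensor_commutator_mult r_def)
  then have "inv (commutator G q x) \<otimes> (commutator G q x \<otimes> (r \<otimes> commutator G r x)) \<otimes> inv (commutator G r x) =
      inv (commutator G q x) \<otimes> inv (commutator G r x)"
    by simp
  then have "r = inv (commutator G q x) \<otimes> inv (commutator G r x)"
    by (simp add: inv_mult_cancel m_assoc)
  moreover have "perp (commutator G q x) x" "perp (commutator G r x) x"
    by (rule engel_perp[OF nc_engel]; simp)+
  ultimately have "perp r x" by (metis perp_inv_left perp_mult_left)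
  then show ?thesis by (simp add: r_def p_def)
qed

text \<open>By \<open>engel_perp_first\<close> the last factor in \<open>engel_linearize\<close>
  vanishes, leaving an alternating law.\<close>

lemma engel_swap:
  assumes [simp]: "x \<in> carrier G" "y \<in> carrier G"
  shows "commutator G a y \<odot> x \<otimes>\<^bsub>T\<^esub> commutator G a x \<odot> y = \<one>\<^bsub>T\<^esub>"
  using engel_linearize[OF assms] engel_perp_first[OF assms] engel_in[OF a]
  by (simp add: perp_def)

text \<open>The boundary of \<open>engel_swap\<close>.\<close>

lemma engel_swap_commutator:
  assumes [simp]: "x \<in> carrier G" "y \<in> carrier G"
  shows "commutator G (commutator G a y) x = inv (commutator G (commutator G a x) y)"
proof -
  note [simp] = engel_in[OF a] nc_closed
  have "tensor_commutator G (commutator G a y \<odot> x \<otimes>\<^bsub>T\<^esub> commutator G a x \<odot> y) = \<one>"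
    by (simp only: engel_swap[OF assms] tensor_commutator_one)
  then have "commutator G (commutator G a y) x \<otimes> commutator G (commutator G a x) y = \<one>"
    by (simp add: tensor_commutator_mult)
  then show ?thesis by (metis inv_equality commutator_in assms engel_in[OF a])
qed

end

section \<open>Triple commutators under permutation of their arguments\<close>

text \<open>
  The symbol \<open>[a, x, y] \<odot> z\<close> changes sign under transposing \<open>x, y\<close> and under transposing
  \<open>y, z\<close>; expanding \<open>[a, xy] \<odot> z\<close> shows that it also changes sign under cyclic rotation.
\<close>

lemma engel_square_perp:
  assumes a: "a \<in> right_2_tensor_engel G"
    and [simp]: "x \<in> carrier G" "y \<in> carrier G" "z \<in> carrier G"
  defines "r \<equiv> commutator G (commutator G a x) y"
  shows "perp (r \<otimes> r) z"
proof -
  define p where "p = commutator G a x"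
  define q where "q = commutator G a y"
  define s where "s = commutator G a z"
  note [simp] = engel_in[OF a] nc_closed[OF a]
  have nc [simp]: "p \<in> normal_closure a" "q \<in> normal_closure a" "s \<in> normal_closure a"
    "r \<in> normal_closure a" "commutator G s x \<in> normal_closure a"
    by (simp_all add: p_def q_def r_def s_def)
  have [simp]: "p \<in> carrier G" "q \<in> carrier G" "r \<in> carrier G" "s \<in> carrier G"
    using nc_in[OF a] nc by blast+
  have p: "p \<in> right_2_tensor_engel G" using nc_engel[OF a] by simp
  have "commutator G a (x \<otimes> y) = q \<otimes> (p \<otimes> r)"
    by (simp add: p_def q_def r_def commutator_mult_right conjugate_eq_mult_commutator)
  then have "commutator G a (x \<otimes> y) \<odot> z = q \<odot> z \<otimes>\<^bsub>T\<^esub> (p \<odot> z \<otimes>\<^bsub>T\<^esub> r \<odot> z)"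
    by (simp add: nc_tensor_mult[OF a])
  \<comment> \<open>The action of \<open>y\<close> on \<open>s \<odot> x\<close> is turned into the
    correction factor by \<open>tensor_commutator_left\<close>.\<close>
  moreover have "s \<odot> (x \<otimes> y) = s \<odot> y \<otimes>\<^bsub>T\<^esub> (s \<odot> x \<otimes>\<^bsub>T\<^esub> commutator G s x \<odot> y)"
    by (simp add: tensor_mult_right_act tensor_commutator_left del: tensor_act_tensor)
  ultimately have "\<one>\<^bsub>T\<^esub> = s \<odot> y \<otimes>\<^bsub>T\<^esub> (s \<odot> x \<otimes>\<^bsub>T\<^esub> commutator G s x \<odot> y) \<otimes>\<^bsub>T\<^esub>
      (q \<odot> z \<otimes>\<^bsub>T\<^esub> (p \<odot> z \<otimes>\<^bsub>T\<^esub> r \<odot> z))"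
    using engel_swap[OF a, of "x \<otimes> y" z] by (simp add: s_def)
  \<comment> \<open>The factors commute, and the first two pairs formed here cancel by
    \<open>engel_swap\<close>.\<close>
  also have "\<dots> = (s \<odot> y \<otimes>\<^bsub>T\<^esub> q \<odot> z) \<otimes>\<^bsub>T\<^esub> ((s \<odot> x \<otimes>\<^bsub>T\<^esub> p \<odot> z) \<otimes>\<^bsub>T\<^esub>
      (commutator G s x \<odot> y \<otimes>\<^bsub>T\<^esub> r \<odot> z))"
    by (simp add: T.m_assoc nc_tensor_commute[OF a] nc_tensor_left_commute[OF a])
  also have "\<dots> = commutator G s x \<odot> y \<otimes>\<^bsub>T\<^esub> r \<odot> z"
    using engel_swap[OF a, of y z] engel_swap[OF a, of x z] by (simp add: p_def q_def s_def)
  also have "commutator G s x = inv (commutator G p z)"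
    unfolding s_def p_def by (rule engel_swap_commutator[OF a]) simp_all
  finally have 1: "inv (commutator G p z) \<odot> y \<otimes>\<^bsub>T\<^esub> r \<odot> z = \<one>\<^bsub>T\<^esub>" ..
  have 2: "inv (commutator G p z) \<odot> y \<otimes>\<^bsub>T\<^esub> commutator G p z \<odot> y = \<one>\<^bsub>T\<^esub>"
    by (subst nc_tensor_mult[OF a, symmetric]) simp_all
  \<comment> \<open>Since \<open>p\<close> is itself Engel, \<open>engel_swap\<close> for
    \<open>p\<close> transposes \<open>y\<close> and \<open>z\<close>.\<close>
  have 3: "r \<odot> z \<otimes>\<^bsub>T\<^esub> commutator G p z \<odot> y = \<one>\<^bsub>T\<^esub>"
    unfolding r_def p_def[symmetric] using engel_swap[OF p, of z y] by simp
  have "commutator G p z \<odot> y \<in> carrier T" "inv (commutator G p z) \<odot> y \<in> carrier T"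
    "r \<odot> z \<in> carrier T"
    by (intro tens_in; simp)+
  \<comment> \<open>Facts 2 and 3 make both sides inverses of the same tensor, so fact 1 becomes a
    square of \<open>r \<odot> z\<close>.\<close>
  then have "r \<odot> z = inv (commutator G p z) \<odot> y"
    using T.right_cancel 2 3 by metis
  with 1 have "(r \<otimes> r) \<odot> z = \<one>\<^bsub>T\<^esub>" by (simp add: nc_tensor_mult[OF a])
  then show ?thesis by (simp add: perp_def)
qed

text \<open>
  Expanding both sides of \<open>[a, xy] = [a, [x\<inverse>, y\<inverse>] yx]\<close> gives
  \<open>[a, [x\<inverse>, y\<inverse>]] = [a, x, y]\<^sup>2\<close>.
\<close>

lemma engel_commutator_commutator_perp:
  assumes a: "a \<in> right_2_tensor_engel G"
    and xyz: "x \<in> carrier G" "y \<in> carrier G" "z \<in> carrier G"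
  shows "perp (commutator G a (commutator G x y)) z"
proof -
  \<comment> \<open>Inverses are inserted because \<open>[inv x, inv y]\<close> is exactly the
    factor that turns \<open>y x\<close> into \<open>x y\<close>; they are removed by instantiation
    at the end.\<close>
  have "perp (commutator G a (commutator G (inv x) (inv y))) z"
    if [simp]: "x \<in> carrier G" "y \<in> carrier G" for x y
  proof -
    define p where "p = commutator G a x"
    define q where "q = commutator G a y"
    define r where "r = commutator G p y"
    define d where "d = commutator G a (commutator G (inv x) (inv y))"
    note [simp] = engel_in[OF a] nc_closed[OF a]
    have nc [simp]: "p \<in> normal_closure a" "q \<in> normal_closure a" "r \<in> normal_closure a"
      "d \<in> normal_closure a"
      by (simp_all add: p_def q_def r_def d_def)
    have [simp]: "p \<in> carrier G" "q \<in> carrier G" "r \<in> carrier G" "d \<in> carrier G"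
      using nc_in[OF a] nc by blast+
    have xy: "commutator G a (x \<otimes> y) = q \<otimes> (p \<otimes> r)"
      by (simp add: p_def q_def r_def commutator_mult_right conjugate_eq_mult_commutator)
    have yx: "commutator G a (y \<otimes> x) = p \<otimes> (q \<otimes> inv r)"
      unfolding r_def p_def q_def
      by (subst engel_swap_commutator[OF a, symmetric])
        (simp_all add: commutator_mult_right conjugate_eq_mult_commutator)
    have "x \<otimes> y = commutator G (inv x) (inv y) \<otimes> (y \<otimes> x)"
      by (simp add: word_simps)
    then have "q \<otimes> (p \<otimes> r) = p \<otimes> (q \<otimes> inv r) \<otimes> conjugate G d (y \<otimes> x)"
      using xy yx commutator_mult_right[of a "commutator G (inv x) (inv y)" "y \<otimes> x"]
      by (simp add: d_def)
    moreover have "q \<otimes> (p \<otimes> r) = p \<otimes> (q \<otimes> inv r) \<otimes> (r \<otimes> r)"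
      by (simp add: m_assoc inv_mult_cancel nc_commute[OF a] nc_left_commute[OF a])
    ultimately have "conjugate G d (y \<otimes> x) = r \<otimes> r" by simp
    then have "d = conjugate G (r \<otimes> r) (inv (y \<otimes> x))"
      by (metis \<open>d \<in> carrier G\<close> conjugate_conjugate_inv(2) m_closed that)
    also have "\<dots> = conjugate G (conjugate G (r \<otimes> r) (inv x)) (inv y)"
      by (simp add: conjugate_conjugate inv_mult_group)
    \<comment> \<open>\<open>r\<close> is perpendicular to \<open>x\<close> and to \<open>y\<close>,
      so both conjugations are trivial.\<close>
    also have "\<dots> = r \<otimes> r"
    proof -
      have "perp r x" unfolding r_def p_def by (rule engel_perp_first[OF a]) simp_all
      moreover have "perp r y" unfolding r_def by (rule engel_perp[OF nc_engel[OF a]]) simp_all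
      ultimately have "perp (r \<otimes> r) (inv x)" "perp (r \<otimes> r) (inv y)"
        by (meson perp_sym perp_inv_left perp_mult_left)+
      then show ?thesis by (simp add: perp_conjugate_eq)
    qed
    finally show ?thesis
      using engel_square_perp[OF a that xyz(3)] by (simp add: d_def r_def p_def)
  qed
  from this[of "inv x" "inv y"] xyz show ?thesis by simp
qed

text \<open>The Engel property of \<open>a\<close> moves \<open>b\<close> to the outside; that of
  \<open>b\<close> then handles a commutator of \<open>b\<close> with \<open>[a, x]\<close>.\<close>

lemma engel_commutator_perp:
  assumes a: "a \<in> right_2_tensor_engel G" and b: "b \<in> right_2_tensor_engel G"
    and [simp]: "x \<in> carrier G" "y \<in> carrier G"
  shows "perp (commutator G (commutator G a b) x) y"
proof -
  have [simp]: "a \<in> carrier G" "b \<in> carrier G" using a b by (simp_all add: engel_in)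
  have "commutator G (commutator G a b) x = commutator G b (commutator G a x)"
    by (simp add: engel_swap_commutator[OF a, of x b] inv_commutator)
  then show ?thesis using engel_commutator_commutator_perp[OF b] by simp
qed

section \<open>The second tensor center\<close>

lemma center_iff:
  "c \<in> second_tensor_center G \<longleftrightarrow>
    c \<in> carrier G \<and> (\<forall>x \<in> carrier G. \<forall>y \<in> carrier G. perp (commutator G c x) y)"
  by (auto simp: second_tensor_center_def perp_def)

lemma center_conjugate:
  assumes "c \<in> second_tensor_center G" "k \<in> carrier G"
  shows "conjugate G c k \<in> second_tensor_center G"
proof -
  have c: "c \<in> carrier G" using assms by (simp add: center_iff)
  have "perp (commutator G (conjugate G c k) x) y" if "x \<in> carrier G" "y \<in> carrier G" for x y
  proof -
    have "perp (commutator G c (conjugate G x (inv k))) (conjugate G y (inv k))"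
      using assms that by (simp add: center_iff)
    from perp_conjugate[OF this assms(2)] show ?thesis
      using that assms c by (simp add: conjugate_commutator)
  qed
  then show ?thesis using c assms by (simp add: center_iff)
qed

text \<open>Expanding \<open>[c \<otimes> d, x]\<close> and \<open>[inv c, x]\<close> produces
  conjugates of \<open>[c, x]\<close>; invariance of the center under conjugation absorbs
  them.\<close>

lemma center_subgroup: "subgroup (second_tensor_center G) G"
proof -
  have conj: "perp (conjugate G (commutator G c x) k) y"
    if "c \<in> second_tensor_center G" "x \<in> carrier G" "y \<in> carrier G" "k \<in> carrier G" for c x y k
    using center_conjugate[OF that(1,4)] that by (simp add: center_iff conjugate_commutator)
  show ?thesis
  proof (rule subgroupI)
    show "second_tensor_center G \<subseteq> carrier G" by (auto simp: center_iff)
    have "commutator G \<one> x = \<one>" if "x \<in> carrier G" for x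
      using that by (simp add: word_simps)
    then have "\<one> \<in> second_tensor_center G" by (simp add: center_iff perp_one_left)
    then show "second_tensor_center G \<noteq> {}" by blast
  next
    fix c assume c: "c \<in> second_tensor_center G"
    then show "inv c \<in> second_tensor_center G"
      using conj[OF c, of _ _ "inv c"]
      by (auto simp: center_iff commutator_inv_left conjugate_inv intro: perp_inv_left)
  next
    fix c d assume cd: "c \<in> second_tensor_center G" "d \<in> second_tensor_center G"
    then show "c \<otimes> d \<in> second_tensor_center G"
      using conj[OF cd(1), of _ _ d]
      by (auto simp: center_iff commutator_mult_left intro: perp_mult_left)
  qed
qed

lemma derived_engel_subset: "derived G (right_2_tensor_engel G) \<subseteq> second_tensor_center G"
  unfolding derived_def
proof (rule generate_subgroup_incl[OF _ center_subgroup], clarify)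
  fix a b assume ab: "a \<in> right_2_tensor_engel G" "b \<in> right_2_tensor_engel G"
  then have [simp]: "a \<in> carrier G" "b \<in> carrier G" by (simp_all add: engel_in)
  have "commutator G a b \<in> second_tensor_center G"
    using engel_commutator_perp[OF ab] by (simp add: center_iff)
  \<comment> \<open>The generator \<open>a b (inv a) (inv b)\<close> of \<open>derived\<close> is
    this conjugate of \<open>[a, b]\<close>.\<close>
  then have "conjugate G (commutator G a b) (inv (b \<otimes> a)) \<in> second_tensor_center G"
    by (rule center_conjugate) simp
  then show "a \<otimes> b \<otimes> inv a \<otimes> inv b \<in> second_tensor_center G"
    by (simp add: word_simps)
qed

end

theorem theorem3p7:
  fixes G :: "('a, 'b) monoid_scheme"
  assumes "group G"
    and "\<And>x. x \<in> carrier G \<Longrightarrow> tensor G x x = \<one>\<^bsub>tensor_square G\<^esub>"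
  shows "derived G (right_2_tensor_engel G) \<subseteq> second_tensor_center G"
proof -
  interpret exterior_group G
    using assms group_tensor_square
    by (intro exterior_group.intro tensor_group.intro exterior_group_axioms.intro)
  show ?thesis by (rule derived_engel_subset)
qed

end
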